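(* Let $m\in\mathbb{N}$ and let $T\colon M_{m,2}\to M_{m,2}$ be a right $D_2$-module map. Then $\|T\|_{cb}=\|T\|$.
   Context: $M_{m,n}$ is the space of $m\times n$ complex matrices with the operator norm, i.e. $M_{m,n}=\mathcal{B}(\mathbb{C}^n,\mathbb{C}^m)$ where $\mathbb{C}^n,\mathbb{C}^m$ carry the $\ell^2$ norm. $D_n\subseteq M_{n,n}$ is the algebra of diagonal $n\times n$ matrices. A right $D_n$-module map on $M_{m,n}$ is a linear map $T\colon M_{m,n}\to M_{m,n}$ with $T(xd)=T(x)d$ for all $x\in M_{m,n}$, $d\in D_n$. For $s,t\in\mathbb{N}$, $M_{s,t}(M_{m,n})$ (the $s\times t$ matrices with entries in $M_{m,n}$) is identified with $M_{sm,tn}$ and carries the operator norm of that space; the ampliation $T_{s,t}$ is the map $T_{s,t}[x_{ij}]=[Tx_{ij}]$ on $M_{s,t}(M_{m,n})$. $\|T\|=\sup\{\|Tx\|\colon \|x\|\le1\}$ and $\|T\|_{cb}=\sup_{s,t\ge1}\|T_{s,t}\|$. *)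

theory Defs
  imports
    "Jordan_Normal_Form.Matrix"
    "HOL-Analysis.L2_Norm"
    "HOL-Library.Extended_Real"
begin

definition l2norm_vec :: "complex vec \<Rightarrow> real" where
  "l2norm_vec v = L2_set (\<lambda>i. cmod (v $ i)) {..<dim_vec v}"

(* The set is nonempty and bounded, so the real supremum is the genuine one. *)
definition opnorm_mat :: "complex mat \<Rightarrow> real" where
  "opnorm_mat A =
     Sup {l2norm_vec (A *\<^sub>v v) | v. v \<in> carrier_vec (dim_col A) \<and> l2norm_vec v \<le> 1}"

definition linear_map_mat :: "nat \<Rightarrow> nat \<Rightarrow> (complex mat \<Rightarrow> complex mat) \<Rightarrow> bool" where
  "linear_map_mat m n T \<longleftrightarrow>
     (\<forall>x \<in> carrier_mat m n. T x \<in> carrier_mat m n) \<and>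
     (\<forall>x \<in> carrier_mat m n. \<forall>y \<in> carrier_mat m n. T (x + y) = T x + T y) \<and>
     (\<forall>c. \<forall>x \<in> carrier_mat m n. T (c \<cdot>\<^sub>m x) = c \<cdot>\<^sub>m T x)"

definition diagonal_algebra :: "nat \<Rightarrow> complex mat set" where
  "diagonal_algebra n = {d \<in> carrier_mat n n. diagonal_mat d}"

definition right_diagonal_module_map ::
    "nat \<Rightarrow> nat \<Rightarrow> (complex mat \<Rightarrow> complex mat) \<Rightarrow> bool" where
  "right_diagonal_module_map m n T \<longleftrightarrow>
     linear_map_mat m n T \<and>
     (\<forall>x \<in> carrier_mat m n. \<forall>d \<in> diagonal_algebra n. T (x * d) = T x * d)"

(* Norm of a map on the m x n matrices. The supremum is taken in ereal, so that no boundedness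
   is presupposed. *)
definition map_norm :: "nat \<Rightarrow> nat \<Rightarrow> (complex mat \<Rightarrow> complex mat) \<Rightarrow> ereal" where
  "map_norm m n T = (SUP x \<in> {x \<in> carrier_mat m n. opnorm_mat x \<le> 1}. ereal (opnorm_mat (T x)))"

(* A block matrix [x_pq] with m x n blocks is the matrix whose entry (k, l) of x_pq
   sits at position (p * m + k, q * n + l); all indices start at 0. *)
definition block_mat :: "nat \<Rightarrow> nat \<Rightarrow> complex mat \<Rightarrow> nat \<Rightarrow> nat \<Rightarrow> complex mat" where
  "block_mat m n X p q = mat m n (\<lambda>(k, l). X $$ (p * m + k, q * n + l))"

definition ampliation ::
    "nat \<Rightarrow> nat \<Rightarrow> nat \<Rightarrow> nat \<Rightarrow> (complex mat \<Rightarrow> complex mat) \<Rightarrow> complex mat \<Rightarrow> complex mat" where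
  "ampliation m n s t T X =
     mat (s * m) (t * n)
       (\<lambda>(i, j). T (block_mat m n X (i div m) (j div n)) $$ (i mod m, j mod n))"

definition cb_norm :: "nat \<Rightarrow> nat \<Rightarrow> (complex mat \<Rightarrow> complex mat) \<Rightarrow> ereal" where
  "cb_norm m n T =
     (SUP (s, t) \<in> {1..} \<times> {1..}. map_norm (s * m) (t * n) (ampliation m n s t T))"

end

theory Submission
  imports Defs "HOL-Analysis.Linear_Algebra"
begin

text \<open>
  A right module map over the diagonal algebra acts on each column separately:
  \<open>T [u, v] = [A u, B v]\<close> for two operators \<open>A\<close>, \<open>B\<close>.  The norm of such a map has a description
  free of matrices: \<open>\<parallel>T\<parallel>\<^sup>2\<close> is the least \<open>c \<ge> 0\<close> such that, for all vectors \<open>u\<close> and \<open>v\<close>,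

  \<open>\<parallel>A u + B v\<parallel>\<^sup>2 \<le> c (\<parallel>u\<parallel>\<^sup>2 + \<parallel>v\<parallel>\<^sup>2 + 2 |\<langle>u, v\<rangle>|)\<close>.   (1)

  The bracket on the right is the maximum of \<open>\<parallel>u + \<omega> v\<parallel>\<^sup>2\<close> over the phases \<open>\<omega>\<close>
  (\<open>worst_phase\<close>).  That \<open>\<parallel>T\<parallel>\<^sup>2\<close> satisfies (1) is \<open>norm_controls_pairs\<close>.

  An ampliation acts in the same way, with \<open>A\<close> and \<open>B\<close> replaced by direct sums of \<open>s\<close> copies
  of themselves and with each of the two columns replaced by \<open>t\<close> columns.  The parameter \<open>t\<close> is
  harmless: to estimate \<open>T\<^sub>s\<^sub>,\<^sub>t(X) \<xi>\<close> only the two combinations \<open>U\<close>, \<open>V\<close> of the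
  columns of \<open>X\<close> with coefficients \<open>\<xi>\<close> matter, and \<open>\<parallel>U + \<omega> V\<parallel> \<le> \<parallel>X\<parallel> \<parallel>\<xi>\<parallel>\<close> for every
  phase.  So everything rests on deriving (1) for the direct sums from (1) itself, with the same
  \<open>c\<close>, even though \<open>|\<Sum> \<langle>u\<^sub>p, v\<^sub>p\<rangle>|\<close> may be much smaller than
  \<open>\<Sum> |\<langle>u\<^sub>p, v\<^sub>p\<rangle>|\<close>.

  This is where the number two of columns enters.  Inequality (1) involves only three real
  quadratic forms in \<open>(u, v)\<close>: \<open>c (\<parallel>u\<parallel>\<^sup>2 + \<parallel>v\<parallel>\<^sup>2) - \<parallel>A u + B v\<parallel>\<^sup>2\<close> and the
  real and imaginary parts of \<open>\<langle>u, v\<rangle>\<close>.  Three Hermitian forms have a convex joint range: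
  the Hermitian \<open>2 \<times> 2\<close> matrices form a real space of dimension \<open>4 > 3\<close>, so the identity can be
  moved within them to a positive matrix of rank at most one without changing the three values
  (\<open>hermitian_forms_rank_one\<close>).  Hence \<open>s\<close> pairs \<open>(u\<^sub>p, v\<^sub>p)\<close> can be merged into a single
  pair at which each form takes the sum of its values (\<open>merge_pairs\<close>), and (1) for that pair is
  (1) for the direct sum.
\<close>

section \<open>Vectors as functions on an initial segment\<close>

text \<open>
  Vectors are functions on the naturals of which only the first \<open>n\<close> values count.  Linear
  combinations are then pointwise, and a block of a long vector is a shift of its index.
\<close>

definition inner_upto :: "nat \<Rightarrow> (nat \<Rightarrow> complex) \<Rightarrow> (nat \<Rightarrow> complex) \<Rightarrow> complex" where
  "inner_upto n f g = (\<Sum>i<n. f i * cnj (g i))"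

definition normsq_upto :: "nat \<Rightarrow> (nat \<Rightarrow> complex) \<Rightarrow> real" where
  "normsq_upto n f = (\<Sum>i<n. (cmod (f i))\<^sup>2)"

lemma normsq_upto_nonneg: "0 \<le> normsq_upto n f"
  by (simp add: normsq_upto_def sum_nonneg)

lemma normsq_upto_cong: "(\<And>i. i < n \<Longrightarrow> f i = g i) \<Longrightarrow> normsq_upto n f = normsq_upto n g"
  by (simp add: normsq_upto_def)

lemma normsq_upto_eq_0D: "normsq_upto n f = 0 \<Longrightarrow> i < n \<Longrightarrow> f i = 0"
  by (auto simp: normsq_upto_def sum_nonneg_eq_0_iff)

lemma normsq_upto_scale: "normsq_upto n (\<lambda>i. c * f i) = (cmod c)\<^sup>2 * normsq_upto n f"
  by (simp add: normsq_upto_def norm_mult power_mult_distrib sum_distrib_left)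

lemma inner_upto_combination:
  "inner_upto n (\<lambda>i. \<alpha> * f i + \<beta> * g i) (\<lambda>i. \<alpha> * f' i + \<beta> * g' i) =
     (cmod \<alpha>)\<^sup>2 * inner_upto n f f' + (cmod \<beta>)\<^sup>2 * inner_upto n g g' +
     \<alpha> * cnj \<beta> * inner_upto n f g' + cnj (\<alpha> * cnj \<beta>) * inner_upto n g f'"
  by (simp add: inner_upto_def sum_distrib_left sum.distrib[symmetric] complex_norm_square
      algebra_simps del: of_real_power)

lemma normsq_upto_combination:
  "normsq_upto n (\<lambda>i. \<alpha> * f i + \<beta> * g i) =
     (cmod \<alpha>)\<^sup>2 * normsq_upto n f + (cmod \<beta>)\<^sup>2 * normsq_upto n g
     + 2 * Re (\<alpha> * cnj \<beta> * inner_upto n f g)"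
proof -
  have "(cmod (\<alpha> * f i + \<beta> * g i))\<^sup>2 = (cmod \<alpha>)\<^sup>2 * (cmod (f i))\<^sup>2 + (cmod \<beta>)\<^sup>2 * (cmod (g i))\<^sup>2
      + 2 * Re (\<alpha> * cnj \<beta> * (f i * cnj (g i)))" for i
    unfolding cmod_power2 by (simp add: power2_eq_square algebra_simps)
  then show ?thesis
    by (simp add: normsq_upto_def inner_upto_def sum_distrib_left sum.distrib)
qed

text \<open>
  The phase that turns the inner product into its absolute value maximizes \<open>\<parallel>f + \<omega> g\<parallel>\<close>.
\<close>

lemma worst_phase:
  obtains \<omega> where "cmod \<omega> = 1"
    "normsq_upto n (\<lambda>i. f i + \<omega> * g i) = normsq_upto n f + normsq_upto n g + 2 * cmod (inner_upto n f g)"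
proof -
  define z where "z = inner_upto n f g"
  define \<omega> where "\<omega> = (if z = 0 then 1 else sgn z)"
  have om: "cmod \<omega> = 1" by (simp add: \<omega>_def norm_sgn)
  have "Re (cnj \<omega> * z) = cmod z"
  proof (cases "z = 0")
    case False
    have "cnj (sgn z) * z = z * cnj z / of_real (cmod z)" by (simp add: sgn_eq)
    also have "\<dots> = of_real (cmod z)"
      using False by (simp add: complex_norm_square[symmetric] power2_eq_square)
    finally have "cnj (sgn z) * z = of_real (cmod z)" .
    with False show ?thesis by (simp add: \<omega>_def)
  qed simp
  with om show ?thesis
    using that[of \<omega>] normsq_upto_combination[of n 1 f \<omega> g] by (simp add: z_def)
qed

section \<open>The operator norm as a quadratic inequality\<close>

lemma l2norm_vec_squared: "(l2norm_vec (vec n f))\<^sup>2 = normsq_upto n f"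
  by (simp add: l2norm_vec_def L2_set_def normsq_upto_def sum_nonneg)

lemma l2norm_vec_nonneg: "0 \<le> l2norm_vec v"
  by (simp add: l2norm_vec_def L2_set_nonneg)

lemma mult_mat_vec_as_sum:
  assumes "A \<in> carrier_mat n k"
  shows "A *\<^sub>v vec k \<xi> = vec n (\<lambda>i. \<Sum>j<k. A $$ (i, j) * \<xi> j)"
  using assms by (intro eq_vecI) (auto simp: scalar_prod_def lessThan_atLeast0)

text \<open>
  The sum of the absolute values of the entries is a crude bound; boundedness is what makes the
  real supremum in the operator norm an upper bound of its set.
\<close>

lemma bdd_above_opnorm_set:
  "bdd_above {l2norm_vec (A *\<^sub>v v) | v. v \<in> carrier_vec (dim_col A) \<and> l2norm_vec v \<le> 1}"
proof (rule bdd_aboveI)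
  fix r assume "r \<in> {l2norm_vec (A *\<^sub>v v) | v. v \<in> carrier_vec (dim_col A) \<and> l2norm_vec v \<le> 1}"
  then obtain v where v: "v \<in> carrier_vec (dim_col A)" "l2norm_vec v \<le> 1"
    and r: "r = l2norm_vec (A *\<^sub>v v)" by blast
  have entry: "cmod (v $ j) \<le> 1" if "j < dim_col A" for j
  proof -
    have "cmod (v $ j) \<le> l2norm_vec v"
      unfolding l2norm_vec_def using v that by (intro member_le_L2_set) auto
    with v show ?thesis by simp
  qed
  have "r \<le> (\<Sum>i<dim_row A. cmod ((A *\<^sub>v v) $ i))"
    unfolding r l2norm_vec_def using L2_set_le_sum[of "{..<dim_row A}" "\<lambda>i. cmod ((A *\<^sub>v v) $ i)"]
    by simp
  also have "\<dots> \<le> (\<Sum>i<dim_row A. \<Sum>j<dim_col A. cmod (A $$ (i, j)))"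
  proof (rule sum_mono)
    fix i assume i: "i \<in> {..<dim_row A}"
    have "cmod ((A *\<^sub>v v) $ i) = cmod (\<Sum>j<dim_col A. A $$ (i, j) * v $ j)"
      using i v by (simp add: scalar_prod_def lessThan_atLeast0)
    also have "\<dots> \<le> (\<Sum>j<dim_col A. cmod (A $$ (i, j)))"
      by (intro sum_norm_le) (use entry in \<open>auto simp: norm_mult intro: mult_left_le\<close>)
    finally show "cmod ((A *\<^sub>v v) $ i) \<le> (\<Sum>j<dim_col A. cmod (A $$ (i, j)))" .
  qed
  finally show "r \<le> (\<Sum>i<dim_row A. \<Sum>j<dim_col A. cmod (A $$ (i, j)))" .
qed

lemma opnorm_mat_nonneg: "0 \<le> opnorm_mat A"
proof -
  have z: "l2norm_vec (0\<^sub>v n) = 0" for n by (simp add: l2norm_vec_def L2_set_def)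
  have "l2norm_vec (A *\<^sub>v 0\<^sub>v (dim_col A)) \<le> opnorm_mat A"
    unfolding opnorm_mat_def by (intro cSup_upper bdd_above_opnorm_set) (auto simp: z)
  then show ?thesis using l2norm_vec_nonneg order_trans by blast
qed

text \<open>
  Squared and made homogeneous in \<open>\<xi>\<close>, a norm bound becomes an inequality between sums of squares,
  which is the form in which upper bounds on operator norms are used and proved below.
\<close>

lemma opnorm_mat_le_iff:
  assumes A: "A \<in> carrier_mat n k" and c: "0 \<le> c"
  shows "opnorm_mat A \<le> c \<longleftrightarrow>
    (\<forall>\<xi>. normsq_upto n (\<lambda>i. \<Sum>j<k. A $$ (i, j) * \<xi> j) \<le> c\<^sup>2 * normsq_upto k \<xi>)"
    (is "_ \<longleftrightarrow> (\<forall>\<xi>. ?N \<xi> \<le> _)")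
proof
  assume le: "opnorm_mat A \<le> c"
  have unit: "?N \<xi> \<le> c\<^sup>2" if "normsq_upto k \<xi> \<le> 1" for \<xi>
  proof -
    have "l2norm_vec (A *\<^sub>v vec k \<xi>) \<le> opnorm_mat A"
      unfolding opnorm_mat_def
    proof (intro cSup_upper bdd_above_opnorm_set CollectI exI conjI refl)
      have "(l2norm_vec (vec k \<xi>))\<^sup>2 \<le> 1\<^sup>2" using that by (simp add: l2norm_vec_squared)
      then show "l2norm_vec (vec k \<xi>) \<le> 1" by (rule power2_le_imp_le) simp
    qed (use A in auto)
    with le have "(l2norm_vec (A *\<^sub>v vec k \<xi>))\<^sup>2 \<le> c\<^sup>2"
      by (intro power_mono l2norm_vec_nonneg) simp
    then show ?thesis by (simp add: mult_mat_vec_as_sum[OF A] l2norm_vec_squared)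
  qed
  show "\<forall>\<xi>. ?N \<xi> \<le> c\<^sup>2 * normsq_upto k \<xi>"
  proof
    fix \<xi>
    show "?N \<xi> \<le> c\<^sup>2 * normsq_upto k \<xi>"
    proof (cases "normsq_upto k \<xi> = 0")
      case True
      then have "\<And>j. j < k \<Longrightarrow> \<xi> j = 0" by (rule normsq_upto_eq_0D)
      with True show ?thesis by (simp add: normsq_upto_def)
    next
      case False
      then have pos: "normsq_upto k \<xi> > 0" using normsq_upto_nonneg[of k \<xi>] by simp
      define r where "r = sqrt (normsq_upto k \<xi>)"
      have r: "r > 0" "r\<^sup>2 = normsq_upto k \<xi>" using pos by (auto simp: r_def)
      have cr: "(cmod (inverse (complex_of_real r)))\<^sup>2 = inverse (r\<^sup>2)"
        using r by (simp add: norm_inverse power_inverse)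
      have "normsq_upto k (\<lambda>j. inverse (complex_of_real r) * \<xi> j) = inverse (r\<^sup>2) * r\<^sup>2"
        by (simp only: normsq_upto_scale cr r(2))
      also have "\<dots> = 1" using r(1) by simp
      finally have "?N (\<lambda>j. inverse (complex_of_real r) * \<xi> j) \<le> c\<^sup>2"
        by (intro unit) simp
      also have "?N (\<lambda>j. inverse (complex_of_real r) * \<xi> j) = inverse (r\<^sup>2) * ?N \<xi>"
        unfolding cr[symmetric] normsq_upto_scale[symmetric] sum_distrib_left
        by (intro normsq_upto_cong sum.cong mult.left_commute refl)
      finally have "inverse (r\<^sup>2) * ?N \<xi> \<le> c\<^sup>2" .
      then have "?N \<xi> \<le> c\<^sup>2 * r\<^sup>2"
        using r(1) by (simp add: divide_inverse[symmetric] mult.commute[of "inverse _"] pos_divide_le_eq)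
      then show ?thesis unfolding r(2) .
    qed
  qed
next
  assume R: "\<forall>\<xi>. ?N \<xi> \<le> c\<^sup>2 * normsq_upto k \<xi>"
  show "opnorm_mat A \<le> c"
    unfolding opnorm_mat_def
  proof (rule cSup_least)
    have "l2norm_vec (0\<^sub>v (dim_col A)) \<le> 1" by (simp add: l2norm_vec_def L2_set_def)
    then show "{l2norm_vec (A *\<^sub>v v) | v. v \<in> carrier_vec (dim_col A) \<and> l2norm_vec v \<le> 1} \<noteq> {}"
      using zero_carrier_vec[of "dim_col A"] by blast
  next
    fix r assume "r \<in> {l2norm_vec (A *\<^sub>v v) | v. v \<in> carrier_vec (dim_col A) \<and> l2norm_vec v \<le> 1}"
    then obtain v where v: "v \<in> carrier_vec k" "l2norm_vec v \<le> 1"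
      and r: "r = l2norm_vec (A *\<^sub>v v)" using A by auto
    have vv: "vec k (\<lambda>j. v $ j) = v" using v by auto
    have "normsq_upto k (\<lambda>j. v $ j) = (l2norm_vec v)\<^sup>2"
      using l2norm_vec_squared[of k "\<lambda>j. v $ j"] by (simp only: vv)
    also have "\<dots> \<le> 1" using v l2norm_vec_nonneg by (simp add: power_le_one)
    finally have "c\<^sup>2 * normsq_upto k (\<lambda>j. v $ j) \<le> c\<^sup>2" by (simp add: mult_left_le)
    moreover have "r\<^sup>2 = ?N (\<lambda>j. v $ j)"
      using mult_mat_vec_as_sum[OF A, of "\<lambda>j. v $ j"] by (simp only: vv r l2norm_vec_squared)
    ultimately have "r\<^sup>2 \<le> c\<^sup>2" using R[rule_format, of "\<lambda>j. v $ j"] by linarith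
    then show "r \<le> c" using c by (rule power2_le_imp_le)
  qed
qed

section \<open>Three Hermitian forms do not see the rank\<close>

text \<open>
  The triple \<open>(p, q, z)\<close> is the Hermitian matrix \<open>\<Delta>\<close> with diagonal \<open>p\<close>, \<open>q\<close> and off-diagonal entry
  \<open>z\<close>.  The line \<open>1 + t \<Delta>\<close> passes through the positive definite identity and, as \<open>\<Delta> \<noteq> 0\<close>,
  leaves the cone of positive matrices in at least one direction.  The matrix at which it leaves
  is positive and singular, hence of the form \<open>w w\<^sup>*\<close> with \<open>w = (\<alpha>, \<beta>)\<close>.
\<close>

lemma rank_one_identity_plus_multiple:
  fixes p q :: real and z :: complex
  assumes "(p, q, z) \<noteq> 0"
  obtains t \<alpha> \<beta> where "(cmod \<alpha>)\<^sup>2 = 1 + t * p" "(cmod \<beta>)\<^sup>2 = 1 + t * q" "\<alpha> * cnj \<beta> = t *\<^sub>R z"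
proof -
  have main: "\<exists>t \<alpha> \<beta>. (cmod \<alpha>)\<^sup>2 = 1 + t * p \<and> (cmod \<beta>)\<^sup>2 = 1 + t * q \<and> \<alpha> * cnj \<beta> = t *\<^sub>R z"
    if ne: "(p, q, z) \<noteq> 0" and tr: "p + q \<ge> 0" for p q :: real and z :: complex
  proof -
    \<comment> \<open>\<open>l\<close> is the larger eigenvalue of \<open>\<Delta>\<close>; it is positive because the trace is nonnegative and
      \<open>\<Delta> \<noteq> 0\<close>, so that \<open>t = - 1 / l\<close> is admissible.\<close>
    define d where "d = sqrt ((p - q)\<^sup>2 + 4 * (cmod z)\<^sup>2)"
    define l where "l = (p + q + d) / 2"
    have d2: "d\<^sup>2 = (p - q)\<^sup>2 + 4 * (cmod z)\<^sup>2" and d0: "d \<ge> 0" by (auto simp: d_def)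
    have dge: "\<bar>p - q\<bar> \<le> d"
      unfolding d_def by (rule real_le_rsqrt) simp
    have "d > 0 \<or> p + q > 0"
    proof (rule ccontr)
      assume "\<not> ?thesis"
      then have "d = 0" "p + q = 0" using d0 tr by auto
      then have "(p - q)\<^sup>2 + 4 * (cmod z)\<^sup>2 = 0" using d2 by simp
      then have "p - q = 0" "z = 0" by (simp_all add: add_nonneg_eq_0_iff)
      with \<open>p + q = 0\<close> ne show False by (auto simp: zero_prod_def)
    qed
    then have l: "l > 0" using d0 tr by (auto simp: l_def)
    have lp: "p \<le> l" and lq: "q \<le> l" using dge by (auto simp: l_def)
    have det: "(l - p) * (l - q) = (cmod z)\<^sup>2"
    proof -
      have "4 * ((l - p) * (l - q)) = d\<^sup>2 - (p - q)\<^sup>2"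
        by (simp add: l_def power2_eq_square field_simps)
      then show ?thesis by (simp add: d2)
    qed
    \<comment> \<open>\<open>P\<close> and \<open>Q\<close> are the diagonal entries of \<open>1 - \<Delta> / l\<close>; they determine \<open>|\<alpha>|\<close> and \<open>|\<beta>|\<close>, and the
      vanishing determinant leaves just a phase \<open>\<omega>\<close> to be matched.\<close>
    define P where "P = 1 - p / l"
    define Q where "Q = 1 - q / l"
    have PQ: "P \<ge> 0" "Q \<ge> 0" using lp lq l by (auto simp: P_def Q_def)
    have "P * Q = (l - p) * (l - q) / l\<^sup>2"
      using l by (simp add: P_def Q_def power2_eq_square field_simps)
    then have prod: "P * Q = (cmod z / l)\<^sup>2" by (simp add: det power_divide)
    define \<omega> where "\<omega> = (if z = 0 then 1 else - sgn z)"
    have om: "cmod \<omega> = 1" "of_real (cmod z) * \<omega> = - z"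
      by (simp_all add: \<omega>_def norm_sgn) (simp add: sgn_eq)
    have "sqrt P * sqrt Q = cmod z / l"
      using l prod by (simp add: real_sqrt_mult[symmetric])
    then have c: "of_real (sqrt P) * \<omega> * cnj (of_real (sqrt Q)) = (- 1 / l) *\<^sub>R z"
    proof -
      have "of_real (sqrt P) * \<omega> * cnj (of_real (sqrt Q)) = of_real (sqrt P * sqrt Q) * \<omega>" by simp
      also have "\<dots> = of_real (cmod z) * \<omega> / of_real l"
        by (simp add: \<open>sqrt P * sqrt Q = cmod z / l\<close> del: of_real_mult)
      finally show ?thesis by (simp add: om scaleR_conv_of_real)
    qed
    have "(cmod (of_real (sqrt P) * \<omega>))\<^sup>2 = 1 + (- 1 / l) * p"
         "(cmod (of_real (sqrt Q)))\<^sup>2 = 1 + (- 1 / l) * q"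
      using PQ om by (simp_all add: norm_mult P_def Q_def)
    with c show ?thesis by blast
  qed
  show ?thesis
  proof (cases "p + q \<ge> 0")
    case True
    with main[OF assms] that show ?thesis by blast
  next
    case False
    \<comment> \<open>Replacing \<open>\<Delta>\<close> by \<open>- \<Delta>\<close> only changes the sign of \<open>t\<close>.\<close>
    have "(- p, - q, - z) \<noteq> 0" using assms by (auto simp: zero_prod_def)
    from main[OF this] False obtain t \<alpha> \<beta> where
      "(cmod \<alpha>)\<^sup>2 = 1 + t * - p" "(cmod \<beta>)\<^sup>2 = 1 + t * - q" "\<alpha> * cnj \<beta> = t *\<^sub>R - z" by auto
    then show ?thesis using that[of \<alpha> "- t" \<beta>] by simp
  qed
qed

text \<open>
  The form with coefficients \<open>a k\<close>, \<open>b k\<close>, \<open>c k\<close> takes the same value at the matrix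
  \<open>w w\<^sup>*\<close>, \<open>w = (\<alpha>, \<beta>)\<close>, as at the identity matrix.  At most three linear conditions on the
  four-dimensional real space of Hermitian matrices have a common nonzero solution \<open>\<Delta>\<close>, and adding a
  multiple of \<open>\<Delta>\<close> to the identity changes none of the values.
\<close>

lemma hermitian_forms_rank_one:
  fixes a b :: "'k \<Rightarrow> real" and c :: "'k \<Rightarrow> complex"
  assumes "finite K" "card K \<le> 3"
  obtains \<alpha> \<beta> where
    "\<And>k. k \<in> K \<Longrightarrow> (cmod \<alpha>)\<^sup>2 * a k + (cmod \<beta>)\<^sup>2 * b k + Re (\<alpha> * cnj \<beta> * c k) = a k + b k"
proof -
  let ?S = "(\<lambda>k. (a k, b k, cnj (c k))) ` K"
  have "dim ?S \<le> card ?S" using assms by (intro dim_le_card') simp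
  also have "\<dots> \<le> 3" using card_image_le[OF assms(1)] assms(2) order_trans by blast
  finally have "dim ?S < DIM(real \<times> real \<times> complex)" by simp
  then obtain x :: "real \<times> real \<times> complex" where "x \<noteq> 0" and
    orth: "\<And>y. y \<in> span ?S \<Longrightarrow> orthogonal x y" by (rule orthogonal_to_subspace_exists) blast
  obtain p q z where x: "x = (p, q, z)" by (cases x)
  obtain t \<alpha> \<beta> where tab: "(cmod \<alpha>)\<^sup>2 = 1 + t * p" "(cmod \<beta>)\<^sup>2 = 1 + t * q" "\<alpha> * cnj \<beta> = t *\<^sub>R z"
    using rank_one_identity_plus_multiple[of p q z] \<open>x \<noteq> 0\<close> x by blast
  show ?thesis
  proof
    fix k assume "k \<in> K"
    then have "(a k, b k, cnj (c k)) \<in> span ?S" by (intro span_base) blast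
    from orth[OF this] have "p * a k + q * b k + Re (z * c k) = 0"
      by (simp add: x orthogonal_def inner_complex_def)
    then have "t * (p * a k + q * b k + Re (z * c k)) = 0" by simp
    then show "(cmod \<alpha>)\<^sup>2 * a k + (cmod \<beta>)\<^sup>2 * b k + Re (\<alpha> * cnj \<beta> * c k) = a k + b k"
      by (simp add: tab algebra_simps)
  qed
qed

section \<open>Merging pairs of vectors\<close>

text \<open>
  Additivity and homogeneity in one equation, required only at the positions below \<open>m\<close>: beyond
  them the column operators introduced further down have no meaningful value.
\<close>

definition linear_upto :: "nat \<Rightarrow> ((nat \<Rightarrow> complex) \<Rightarrow> nat \<Rightarrow> complex) \<Rightarrow> bool" where
  "linear_upto m L \<longleftrightarrow>
     (\<forall>a b f g. \<forall>i<m. L (\<lambda>k. a * f k + b * g k) i = a * L f i + b * L g i)"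

lemma linear_uptoD:
  assumes "linear_upto m L" "i < m"
  shows "L (\<lambda>k. a * f k + b * g k) i = a * L f i + b * L g i"
  using assms by (simp add: linear_upto_def)

lemma linear_upto_sum:
  assumes "linear_upto m L" "i < m"
  shows "L (\<lambda>k. \<Sum>j<n. c j * f j k) i = (\<Sum>j<(n::nat). c j * L (f j) i)"
proof (induction n)
  case 0
  have "L (\<lambda>k. 0 * g k + 0 * g k) i = 0 * L g i + 0 * L g i" for g
    using assms by (rule linear_uptoD)
  then show ?case by simp
next
  case (Suc n)
  have "L (\<lambda>k. 1 * (\<Sum>j<n. c j * f j k) + c n * f n k) i =
      1 * L (\<lambda>k. \<Sum>j<n. c j * f j k) i + c n * L (f n) i"
    using assms by (rule linear_uptoD)
  with Suc show ?case by simp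
qed

text \<open>
  Along the combinations \<open>\<alpha> (u1, v1) + \<beta> (u2, v2)\<close> the real form \<open>F\<close> and the two real components of
  the inner product are three Hermitian forms in \<open>(\<alpha>, \<beta>)\<close>, and the desired right-hand sides are
  their values at the identity matrix.
\<close>

lemma merge_two_pairs:
  fixes c :: real
  assumes L0: "linear_upto m L0" and L1: "linear_upto m L1"
  defines "F \<equiv> \<lambda>u v. c * (normsq_upto m u + normsq_upto m v) - normsq_upto m (\<lambda>i. L0 u i + L1 v i)"
  obtains u v where "F u v = F u1 v1 + F u2 v2"
    "inner_upto m u v = inner_upto m u1 v1 + inner_upto m u2 v2"
proof -
  let ?y1 = "\<lambda>i. L0 u1 i + L1 v1 i" and ?y2 = "\<lambda>i. L0 u2 i + L1 v2 i"
  define x where "x = inner_upto m u1 v2"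
  define y where "y = inner_upto m u2 v1"
  \<comment> \<open>The lists hold the coefficients of the three forms.  The imaginary part of the inner product is
    rewritten as a real part, which accounts for the factor \<open>- \<i>\<close>.\<close>
  define a where "a = (\<lambda>k. [F u1 v1, Re (inner_upto m u1 v1), Im (inner_upto m u1 v1)] ! k)"
  define b where "b = (\<lambda>k. [F u2 v2, Re (inner_upto m u2 v2), Im (inner_upto m u2 v2)] ! k)"
  define d where "d = (\<lambda>k. [2 * (c * (inner_upto m u1 u2 + inner_upto m v1 v2) - inner_upto m ?y1 ?y2),
                            x + cnj y, - \<i> * (x - cnj y)] ! k)"
  obtain \<alpha> \<beta> where ab: "\<And>k. k \<in> {0, 1, 2::nat} \<Longrightarrow>
      (cmod \<alpha>)\<^sup>2 * a k + (cmod \<beta>)\<^sup>2 * b k + Re (\<alpha> * cnj \<beta> * d k) = a k + b k"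
    using hermitian_forms_rank_one[of "{0, 1, 2::nat}" a b d] by auto
  let ?u = "\<lambda>i. \<alpha> * u1 i + \<beta> * u2 i" and ?v = "\<lambda>i. \<alpha> * v1 i + \<beta> * v2 i"
  have lin: "L0 ?u i + L1 ?v i = \<alpha> * ?y1 i + \<beta> * ?y2 i" if "i < m" for i
    unfolding linear_uptoD[OF L0 that] linear_uptoD[OF L1 that] by (simp add: algebra_simps)
  have "normsq_upto m (\<lambda>i. L0 ?u i + L1 ?v i) = normsq_upto m (\<lambda>i. \<alpha> * ?y1 i + \<beta> * ?y2 i)"
    by (intro normsq_upto_cong lin)
  then have "F ?u ?v = (cmod \<alpha>)\<^sup>2 * a 0 + (cmod \<beta>)\<^sup>2 * b 0 + Re (\<alpha> * cnj \<beta> * d 0)"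
    unfolding F_def a_def b_def d_def normsq_upto_combination
    by (simp add: algebra_simps)
  then have 1: "F ?u ?v = F u1 v1 + F u2 v2" using ab[of 0] by (simp add: a_def b_def)
  have "Re (inner_upto m ?u ?v) = Re (inner_upto m u1 v1 + inner_upto m u2 v2)"
    unfolding inner_upto_combination using ab[of 1] 
    by (simp add: a_def b_def d_def x_def[symmetric] y_def[symmetric] algebra_simps)
  moreover have "Im (inner_upto m ?u ?v) = Im (inner_upto m u1 v1 + inner_upto m u2 v2)"
    unfolding inner_upto_combination using ab[of 2]
    by (simp add: a_def b_def d_def x_def[symmetric] y_def[symmetric] algebra_simps)
  ultimately show ?thesis using that 1 complex_eqI by blast
qed

lemma merge_pairs:
  fixes c :: real
  assumes L0: "linear_upto m L0" and L1: "linear_upto m L1"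
  defines "F \<equiv> \<lambda>u v. c * (normsq_upto m u + normsq_upto m v) - normsq_upto m (\<lambda>i. L0 u i + L1 v i)"
  shows "\<exists>u v. F u v = (\<Sum>p<s. F (us p) (vs p)) \<and>
    inner_upto m u v = (\<Sum>p<(s::nat). inner_upto m (us p) (vs p))"
proof (induction s)
  case 0
  have "L0 (\<lambda>_. 0) i = 0" "L1 (\<lambda>_. 0) i = 0" if "i < m" for i
    using linear_upto_sum[OF L0 that, of _ _ 0] linear_upto_sum[OF L1 that, of _ _ 0] by simp_all
  then have "F (\<lambda>_. 0) (\<lambda>_. 0) = 0" "inner_upto m (\<lambda>_. 0) (\<lambda>_. 0) = 0"
    by (simp_all add: F_def normsq_upto_def inner_upto_def)
  then show ?case by (metis lessThan_0 sum.empty)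
next
  case (Suc s)
  then obtain u v where uv: "F u v = (\<Sum>p<s. F (us p) (vs p))"
    "inner_upto m u v = (\<Sum>p<s. inner_upto m (us p) (vs p))" by blast
  obtain u' v' where "F u' v' = F u v + F (us s) (vs s)"
    "inner_upto m u' v' = inner_upto m u v + inner_upto m (us s) (vs s)"
    unfolding F_def by (rule merge_two_pairs[OF L0 L1])
  with uv show ?case by (metis sum.lessThan_Suc)
qed

text \<open>
  The difference of the two sides depends on the family only through the sums of the three merged
  forms, so that the inequality for a single pair carries over with the same constant.
\<close>

lemma bound_for_direct_sums:
  assumes L0: "linear_upto m L0" and L1: "linear_upto m L1"
    and single: "\<And>u v. normsq_upto m (\<lambda>i. L0 u i + L1 v i) \<le>
      c * (normsq_upto m u + normsq_upto m v + 2 * cmod (inner_upto m u v))"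
  shows "(\<Sum>p<s. normsq_upto m (\<lambda>i. L0 (us p) i + L1 (vs p) i)) \<le>
    c * ((\<Sum>p<s. normsq_upto m (us p)) + (\<Sum>p<s. normsq_upto m (vs p))
         + 2 * cmod (\<Sum>p<(s::nat). inner_upto m (us p) (vs p)))"
proof -
  obtain u v where "c * (normsq_upto m u + normsq_upto m v) - normsq_upto m (\<lambda>i. L0 u i + L1 v i) =
      (\<Sum>p<s. c * (normsq_upto m (us p) + normsq_upto m (vs p))
             - normsq_upto m (\<lambda>i. L0 (us p) i + L1 (vs p) i))"
    and "inner_upto m u v = (\<Sum>p<s. inner_upto m (us p) (vs p))"
    using merge_pairs[OF L0 L1, where c = c and s = s and us = us and vs = vs] by blast
  with single[of u v] show ?thesis
    by (simp add: sum_subtractf sum.distrib sum_distrib_left[symmetric] algebra_simps)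
qed

section \<open>Module maps act on columns\<close>

text \<open>
  The operator by which \<open>T\<close> acts on column \<open>j\<close>, read off from matrices whose other columns vanish.
\<close>

definition column_map :: "nat \<Rightarrow> nat \<Rightarrow> (complex mat \<Rightarrow> complex mat) \<Rightarrow> nat \<Rightarrow>
    (nat \<Rightarrow> complex) \<Rightarrow> nat \<Rightarrow> complex" where
  "column_map m n T j f i = T (mat m n (\<lambda>(k, l). if l = j then f k else 0)) $$ (i, j)"

lemma linear_upto_column_map:
  assumes T: "linear_map_mat m n T" and j: "j < n"
  shows "linear_upto m (column_map m n T j)"
  unfolding linear_upto_def
proof (intro allI impI)
  fix a b f g i assume i: "i < m"
  let ?C = "\<lambda>f. mat m n (\<lambda>(k, l). if l = j then f k else 0) :: complex mat"
  have "?C (\<lambda>k. a * f k + b * g k) = a \<cdot>\<^sub>m ?C f + b \<cdot>\<^sub>m ?C g"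
    by (intro eq_matI) auto
  moreover have "T (a \<cdot>\<^sub>m ?C f + b \<cdot>\<^sub>m ?C g) = a \<cdot>\<^sub>m T (?C f) + b \<cdot>\<^sub>m T (?C g)"
    using T unfolding linear_map_mat_def by simp
  moreover have "T (?C f) \<in> carrier_mat m n" "T (?C g) \<in> carrier_mat m n"
    using T unfolding linear_map_mat_def by simp_all
  ultimately show "column_map m n T j (\<lambda>k. a * f k + b * g k) i =
      a * column_map m n T j f i + b * column_map m n T j g i"
    using i j by (simp add: column_map_def)
qed

text \<open>
  Multiplying by the diagonal matrix unit of \<open>j\<close> on the right keeps column \<open>j\<close> and erases the
  others; the module property lets \<open>T\<close> commute with this.
\<close>

lemma module_map_acts_on_columns:
  assumes T: "right_diagonal_module_map m n T" and x: "x \<in> carrier_mat m n"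
    and i: "i < m" and j: "j < n"
  shows "T x $$ (i, j) = column_map m n T j (\<lambda>k. x $$ (k, j)) i"
proof -
  define e where "e = mat n n (\<lambda>(k, l). if k = j \<and> l = j then 1 else 0 :: complex)"
  have e: "e \<in> diagonal_algebra n" by (auto simp: e_def diagonal_algebra_def diagonal_mat_def)
  have mult: "(y * e) $$ (k, l) = (if l = j then y $$ (k, j) else 0)"
    if "y \<in> carrier_mat m n" "k < m" "l < n" for y k l
  proof -
    have "(y * e) $$ (k, l) = (\<Sum>r<n. y $$ (k, r) * (if r = j \<and> l = j then 1 else 0))"
      using that by (simp add: e_def scalar_prod_def lessThan_atLeast0)
    also have "\<dots> = (\<Sum>r<n. if r = j then (if l = j then y $$ (k, j) else 0) else 0)"
      by (intro sum.cong) auto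
    also have "\<dots> = (if l = j then y $$ (k, j) else 0)" using j by simp
    finally show ?thesis .
  qed
  have Tx: "T x \<in> carrier_mat m n"
    using T x unfolding right_diagonal_module_map_def linear_map_mat_def by blast
  have "x * e = mat m n (\<lambda>(k, l). if l = j then x $$ (k, j) else 0)"
    using x by (intro eq_matI) (auto simp: mult, auto simp: e_def)
  then have "column_map m n T j (\<lambda>k. x $$ (k, j)) i = T (x * e) $$ (i, j)"
    by (simp add: column_map_def)
  also have "T (x * e) = T x * e"
    using T x e unfolding right_diagonal_module_map_def by blast
  also have "\<dots> $$ (i, j) = T x $$ (i, j)" using mult[OF Tx i j] by simp
  finally show ?thesis by simp
qed

text \<open>
  Set \<open>k = |\<langle>u, v\<rangle>|\<close>, \<open>a\<^sup>2 = \<parallel>u\<parallel>\<^sup>2 + k\<close> and \<open>b\<^sup>2 = \<parallel>v\<parallel>\<^sup>2 + k\<close>.  The matrix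
  \<open>x = [u / a, v / b]\<close> is a contraction, since its mixed term \<open>2 |\<alpha>| |\<beta>| k\<close> is at most
  \<open>(|\<alpha>|\<^sup>2 + |\<beta>|\<^sup>2) k\<close>.  Applying \<open>T x\<close> to the vector \<open>(a, b)\<close> gives the left-hand side, and
  \<open>a\<^sup>2 + b\<^sup>2\<close> is the bracket on the right.
\<close>

lemma norm_controls_pairs:
  assumes T: "right_diagonal_module_map m 2 T" and N: "0 \<le> N"
    and bd: "\<And>x. x \<in> carrier_mat m 2 \<Longrightarrow> opnorm_mat x \<le> 1 \<Longrightarrow> opnorm_mat (T x) \<le> N"
  shows "normsq_upto m (\<lambda>i. column_map m 2 T 0 u i + column_map m 2 T 1 v i) \<le>
    N\<^sup>2 * (normsq_upto m u + normsq_upto m v + 2 * cmod (inner_upto m u v))"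
proof -
  define k where "k = cmod (inner_upto m u v)"
  define a where "a = sqrt (normsq_upto m u + k)"
  define b where "b = sqrt (normsq_upto m v + k)"
  have k0: "k \<ge> 0" by (simp add: k_def)
  have a: "a \<ge> 0" "a\<^sup>2 = normsq_upto m u + k" and b: "b \<ge> 0" "b\<^sup>2 = normsq_upto m v + k"
    using normsq_upto_nonneg k0 by (simp_all add: a_def b_def)
  define x where "x = mat m 2 (\<lambda>(i, j). if j = 0 then u i / of_real a else v i / of_real b)"
  have x: "x \<in> carrier_mat m 2" by (simp add: x_def)
  have two: "(\<Sum>j<2. h j) = h 0 + h 1" for h :: "nat \<Rightarrow> 'z::comm_monoid_add"
    by (simp add: numeral_2_eq_2)
  have "opnorm_mat x \<le> 1"
    unfolding opnorm_mat_le_iff[OF x zero_le_one]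
  proof
    fix \<xi> :: "nat \<Rightarrow> complex"
    let ?\<alpha> = "\<xi> 0 / of_real a" and ?\<beta> = "\<xi> 1 / of_real b"
    let ?A = "(cmod ?\<alpha>)\<^sup>2" and ?B = "(cmod ?\<beta>)\<^sup>2"
    have "normsq_upto m (\<lambda>i. \<Sum>j<2. x $$ (i, j) * \<xi> j) = normsq_upto m (\<lambda>i. ?\<alpha> * u i + ?\<beta> * v i)"
      by (intro normsq_upto_cong) (simp add: two x_def mult.commute)
    also have "\<dots> = ?A * normsq_upto m u + ?B * normsq_upto m v
        + 2 * Re (?\<alpha> * cnj ?\<beta> * inner_upto m u v)"
      by (rule normsq_upto_combination)
    also have "2 * Re (?\<alpha> * cnj ?\<beta> * inner_upto m u v) \<le> (?A + ?B) * k"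
    proof -
      have "Re (?\<alpha> * cnj ?\<beta> * inner_upto m u v) \<le> cmod (?\<alpha> * cnj ?\<beta> * inner_upto m u v)"
        by (rule complex_Re_le_cmod)
      also have "\<dots> = cmod ?\<alpha> * cmod ?\<beta> * k"
        by (simp only: norm_mult complex_mod_cnj k_def)
      finally have "2 * Re (?\<alpha> * cnj ?\<beta> * inner_upto m u v) \<le> 2 * cmod ?\<alpha> * cmod ?\<beta> * k" by linarith
      also have "\<dots> \<le> (?A + ?B) * k"
        by (intro mult_right_mono sum_squares_bound k0)
      finally show ?thesis .
    qed
    finally have "normsq_upto m (\<lambda>i. \<Sum>j<2. x $$ (i, j) * \<xi> j) \<le> ?A * a\<^sup>2 + ?B * b\<^sup>2"
      by (simp add: a b algebra_simps)
    also have "?A * a\<^sup>2 \<le> (cmod (\<xi> 0))\<^sup>2"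
      by (cases "a = 0") (auto simp: norm_divide power_divide)
    also have "?B * b\<^sup>2 \<le> (cmod (\<xi> 1))\<^sup>2"
      by (cases "b = 0") (auto simp: norm_divide power_divide)
    finally show "normsq_upto m (\<lambda>i. \<Sum>j<2. x $$ (i, j) * \<xi> j) \<le> 1\<^sup>2 * normsq_upto 2 \<xi>"
      by (simp add: normsq_upto_def two)
  qed
  then have "opnorm_mat (T x) \<le> N" using bd x by blast
  moreover have Tx: "T x \<in> carrier_mat m 2"
    using T x unfolding right_diagonal_module_map_def linear_map_mat_def by blast
  ultimately have le: "normsq_upto m (\<lambda>i. \<Sum>j<2. T x $$ (i, j) * \<xi> j) \<le> N\<^sup>2 * normsq_upto 2 \<xi>" for \<xi>
    using opnorm_mat_le_iff[OF Tx N] by blast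
  define \<xi> where "\<xi> = (\<lambda>j. if j = (0::nat) then complex_of_real a else of_real b)"
  have lin: "linear_upto m (column_map m 2 T j)" if "j < 2" for j
    using T that linear_upto_column_map unfolding right_diagonal_module_map_def by blast
  have scale: "column_map m 2 T j f i = T x $$ (i, j) * of_real r"
    if "i < m" "j < 2" and f: "\<And>k. k < m \<Longrightarrow> f k = x $$ (k, j) * of_real r" for i j f r
  proof -
    have "column_map m 2 T j f i = column_map m 2 T j (\<lambda>k. of_real r * x $$ (k, j) + 0 * 0) i"
      unfolding column_map_def by (intro arg_cong[where f = "\<lambda>y. T y $$ (i, j)"] eq_matI) (auto simp: f)
    also have "\<dots> = of_real r * column_map m 2 T j (\<lambda>k. x $$ (k, j)) i + 0 * column_map m 2 T j (\<lambda>k. 0) i"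
      using lin[OF \<open>j < 2\<close>] \<open>i < m\<close> by (rule linear_uptoD)
    finally show ?thesis
      using module_map_acts_on_columns[OF T x \<open>i < m\<close> \<open>j < 2\<close>] by simp
  qed
  \<comment> \<open>If \<open>a\<close> is zero then so is \<open>u\<close>, and the column \<open>u / a\<close>, zero by the convention on division,
    still satisfies the equation.\<close>
  have u: "u i = x $$ (i, 0) * of_real a" if "i < m" for i
  proof (cases "a = 0")
    case True
    then have "normsq_upto m u = 0" using a k0 normsq_upto_nonneg[of m u] by simp
    then show ?thesis using True that by (simp add: normsq_upto_eq_0D)
  qed (use that in \<open>simp add: x_def\<close>)
  have v: "v i = x $$ (i, 1) * of_real b" if "i < m" for i
  proof (cases "b = 0")
    case True
    then have "normsq_upto m v = 0" using b k0 normsq_upto_nonneg[of m v] by simp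
    then show ?thesis using True that by (simp add: normsq_upto_eq_0D)
  qed (use that in \<open>simp add: x_def\<close>)
  have "normsq_upto m (\<lambda>i. column_map m 2 T 0 u i + column_map m 2 T 1 v i) =
      normsq_upto m (\<lambda>i. \<Sum>j<2. T x $$ (i, j) * \<xi> j)"
  proof (rule normsq_upto_cong)
    fix i assume i: "i < m"
    show "column_map m 2 T 0 u i + column_map m 2 T 1 v i = (\<Sum>j<2. T x $$ (i, j) * \<xi> j)"
      using scale[OF i _ u] scale[OF i _ v] by (simp add: two \<xi>_def)
  qed
  also have "\<dots> \<le> N\<^sup>2 * normsq_upto 2 \<xi>" by (rule le)
  also have "normsq_upto 2 \<xi> = normsq_upto m u + normsq_upto m v + 2 * k"
    by (simp add: normsq_upto_def two \<xi>_def) (simp add: a b normsq_upto_def)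
  finally show ?thesis by (simp add: k_def)
qed

section \<open>Ampliations\<close>

lemma sum_blocks: "(\<Sum>i<s * m. g i) = (\<Sum>p<s. \<Sum>k<m. g (p * m + k :: nat))"
proof -
  have "(\<Sum>p<s. \<Sum>k<m. g (p * m + k)) = (\<Sum>p<s. sum g {p * m..<p * m + m})"
  proof (rule sum.cong)
    fix p
    show "(\<Sum>k<m. g (p * m + k)) = sum g {p * m..<p * m + m}"
      using sum.shift_bounds_nat_ivl[of g 0 "p * m" m] by (simp add: lessThan_atLeast0 add.commute)
  qed simp
  also have "\<dots> = sum g {..<s * m}" by (rule sum.nat_group)
  finally show ?thesis by simp
qed

text \<open>
  In the interleaved numbering of the columns of \<open>X\<close>, the even ones are acted on by the first
  column operator and the odd ones by the second, block by block.  So \<open>\<xi>\<close> enters only through the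
  combinations \<open>U\<close> of the even and \<open>V\<close> of the odd columns.
\<close>

lemma ampliation_bound:
  assumes T: "right_diagonal_module_map m 2 T" and N: "0 \<le> N"
    and bd: "\<And>x. x \<in> carrier_mat m 2 \<Longrightarrow> opnorm_mat x \<le> 1 \<Longrightarrow> opnorm_mat (T x) \<le> N"
    and X: "X \<in> carrier_mat (s * m) (t * 2)" and X1: "opnorm_mat X \<le> 1"
  shows "opnorm_mat (ampliation m 2 s t T X) \<le> N"
proof -
  let ?Y = "ampliation m 2 s t T X"
  let ?L = "column_map m 2 T"
  have Y: "?Y \<in> carrier_mat (s * m) (t * 2)" by (simp add: ampliation_def)
  have lin0: "linear_upto m (?L 0)" and lin1: "linear_upto m (?L 1)"
    using T linear_upto_column_map[of m 2 T] by (simp_all add: right_diagonal_module_map_def)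
  show ?thesis
    unfolding opnorm_mat_le_iff[OF Y N]
  proof
    fix \<xi> :: "nat \<Rightarrow> complex"
    let ?ev = "\<lambda>j. if even j then \<xi> j else 0" and ?od = "\<lambda>j. if odd j then \<xi> j else 0"
    define U where "U = (\<lambda>i. \<Sum>j<t * 2. ?ev j * X $$ (i, j))"
    define V where "V = (\<lambda>i. \<Sum>j<t * 2. ?od j * X $$ (i, j))"
    have entry: "?Y $$ (p * m + k, j) = ?L (j mod 2) (\<lambda>l. X $$ (p * m + l, j)) k"
      if "p < s" "k < m" "j < t * 2" for p k j
    proof -
      have "p * m + k < s * m"
        using that mult_le_mono1[of "Suc p" s m] by simp
      then have "?Y $$ (p * m + k, j) = T (block_mat m 2 X p (j div 2)) $$ (k, j mod 2)"
        using that by (simp add: ampliation_def)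
      also have "\<dots> = ?L (j mod 2) (\<lambda>l. block_mat m 2 X p (j div 2) $$ (l, j mod 2)) k"
        by (rule module_map_acts_on_columns[OF T]) (use that in \<open>simp_all add: block_mat_def\<close>)
      also have "\<dots> = ?L (j mod 2) (\<lambda>l. X $$ (p * m + l, j)) k"
        unfolding column_map_def
        by (intro arg_cong[where f = "\<lambda>y. T y $$ _"] eq_matI) (auto simp: block_mat_def)
      finally show ?thesis .
    qed
    have apply_Y: "(\<Sum>j<t * 2. ?Y $$ (p * m + k, j) * \<xi> j) =
        ?L 0 (\<lambda>l. U (p * m + l)) k + ?L 1 (\<lambda>l. V (p * m + l)) k" if "p < s" "k < m" for p k
    proof -
      have "?L 0 (\<lambda>l. U (p * m + l)) k + ?L 1 (\<lambda>l. V (p * m + l)) k =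
          (\<Sum>j<t * 2. ?ev j * ?L 0 (\<lambda>l. X $$ (p * m + l, j)) k
                    + ?od j * ?L 1 (\<lambda>l. X $$ (p * m + l, j)) k)"
        unfolding U_def V_def
        by (simp only: linear_upto_sum[OF lin0 that(2)] linear_upto_sum[OF lin1 that(2)] sum.distrib)
      also have "\<dots> = (\<Sum>j<t * 2. ?Y $$ (p * m + k, j) * \<xi> j)"
        by (intro sum.cong refl) (auto simp: entry that mod_2_eq_odd)
      finally show ?thesis by simp
    qed
    have blocks: "normsq_upto (s * m) f = (\<Sum>p<s. normsq_upto m (\<lambda>k. f (p * m + k)))" for f
      by (simp add: normsq_upto_def sum_blocks)
    have "normsq_upto (s * m) (\<lambda>i. \<Sum>j<t * 2. ?Y $$ (i, j) * \<xi> j) =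
        (\<Sum>p<s. normsq_upto m (\<lambda>k. ?L 0 (\<lambda>l. U (p * m + l)) k + ?L 1 (\<lambda>l. V (p * m + l)) k))"
      unfolding blocks by (intro sum.cong refl normsq_upto_cong apply_Y) auto
    also have "\<dots> \<le> N\<^sup>2 * ((\<Sum>p<s. normsq_upto m (\<lambda>l. U (p * m + l)))
        + (\<Sum>p<s. normsq_upto m (\<lambda>l. V (p * m + l)))
        + 2 * cmod (\<Sum>p<s. inner_upto m (\<lambda>l. U (p * m + l)) (\<lambda>l. V (p * m + l))))"
      by (intro bound_for_direct_sums lin0 lin1 norm_controls_pairs[OF T N bd]) auto
    also have "\<dots> = N\<^sup>2 * (normsq_upto (s * m) U + normsq_upto (s * m) V
        + 2 * cmod (inner_upto (s * m) U V))"
      by (simp add: blocks inner_upto_def sum_blocks)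
    also have "\<dots> \<le> N\<^sup>2 * normsq_upto (t * 2) \<xi>"
    proof (rule mult_left_mono)
      obtain \<omega> where om: "cmod \<omega> = 1" and eq: "normsq_upto (s * m) (\<lambda>i. U i + \<omega> * V i) =
          normsq_upto (s * m) U + normsq_upto (s * m) V + 2 * cmod (inner_upto (s * m) U V)"
        by (rule worst_phase)
      \<comment> \<open>Turning the odd coordinates of \<open>\<xi>\<close> by the phase \<open>\<omega>\<close> preserves its norm and changes
        \<open>X \<xi> = U + V\<close> into \<open>U + \<omega> V\<close>.\<close>
      define \<xi>' where "\<xi>' = (\<lambda>j. if even j then \<xi> j else \<omega> * \<xi> j)"
      have "U i + \<omega> * V i = (\<Sum>j<t * 2. X $$ (i, j) * \<xi>' j)" for i
        unfolding U_def V_def \<xi>'_def sum_distrib_left sum.distrib[symmetric]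
        by (intro sum.cong) auto
      moreover have "normsq_upto (s * m) (\<lambda>i. \<Sum>j<t * 2. X $$ (i, j) * \<xi>' j) \<le> 1\<^sup>2 * normsq_upto (t * 2) \<xi>'"
        using opnorm_mat_le_iff[OF X zero_le_one] X1 by blast
      moreover have "normsq_upto (t * 2) \<xi>' = normsq_upto (t * 2) \<xi>"
        unfolding normsq_upto_def by (intro sum.cong) (auto simp: \<xi>'_def norm_mult om)
      ultimately show "normsq_upto (s * m) U + normsq_upto (s * m) V
          + 2 * cmod (inner_upto (s * m) U V) \<le> normsq_upto (t * 2) \<xi>"
        by (simp add: eq[symmetric])
    qed simp
    finally show "normsq_upto (s * m) (\<lambda>i. \<Sum>j<t * 2. ?Y $$ (i, j) * \<xi> j) \<le> N\<^sup>2 * normsq_upto (t * 2) \<xi>" .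
  qed
qed

lemma ampliation_1_1:
  assumes T: "linear_map_mat m n T" and X: "X \<in> carrier_mat m n"
  shows "ampliation m n 1 1 T X = T X"
proof -
  have "block_mat m n X 0 0 = X" using X by (intro eq_matI) (auto simp: block_mat_def)
  moreover have "T X \<in> carrier_mat m n" using T X by (simp add: linear_map_mat_def)
  ultimately show ?thesis by (intro eq_matI) (auto simp: ampliation_def)
qed

theorem theorem3p2:
  fixes m :: nat and T :: "complex mat \<Rightarrow> complex mat"
  assumes "right_diagonal_module_map m 2 T"
  shows "cb_norm m 2 T = map_norm m 2 T"
proof (rule antisym)
  have lin: "linear_map_mat m 2 T" using assms by (simp add: right_diagonal_module_map_def)
  have "map_norm m 2 T = map_norm (1 * m) (1 * 2) (ampliation m 2 1 1 T)"
    using ampliation_1_1[OF lin] by (simp add: map_norm_def)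
  also have "\<dots> \<le> cb_norm m 2 T"
    unfolding cb_norm_def by (rule SUP_upper2[of "(1, 1)"]) auto
  finally show "map_norm m 2 T \<le> cb_norm m 2 T" .
  have zero: "opnorm_mat (0\<^sub>m m 2) \<le> 1"
    by (subst opnorm_mat_le_iff[of _ m 2]) (simp_all add: normsq_upto_def sum_nonneg)
  show "cb_norm m 2 T \<le> map_norm m 2 T"
  proof (cases "map_norm m 2 T")
    case (real N)
    have bd: "opnorm_mat (T x) \<le> N" if "x \<in> carrier_mat m 2" "opnorm_mat x \<le> 1" for x
    proof -
      have "ereal (opnorm_mat (T x)) \<le> map_norm m 2 T"
        unfolding map_norm_def using that by (intro SUP_upper) simp
      then show ?thesis by (simp add: real)
    qed
    have "0 \<le> N" using zero bd[of "0\<^sub>m m 2"] opnorm_mat_nonneg[of "T (0\<^sub>m m 2)"] by simp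
    have "map_norm (s * m) (t * 2) (ampliation m 2 s t T) \<le> ereal N" for s t
      unfolding map_norm_def
    proof (rule SUP_least)
      fix X assume "X \<in> {x \<in> carrier_mat (s * m) (t * 2). opnorm_mat x \<le> 1}"
      then show "ereal (opnorm_mat (ampliation m 2 s t T X)) \<le> ereal N"
        using ampliation_bound[OF assms \<open>0 \<le> N\<close> bd] by simp
    qed
    then show ?thesis
      unfolding cb_norm_def real by (intro SUP_least) auto
  next
    case MInf
    have "ereal (opnorm_mat (T (0\<^sub>m m 2))) \<le> map_norm m 2 T"
      unfolding map_norm_def by (intro SUP_upper) (simp add: zero)
    with MInf show ?thesis by simp
  qed simp
qed

end
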